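(* $\mathbb X\equiv\mathbb W_G$, $\mathbb X_{nc}\equiv\mathbb W_{nc}$ and $\mathbb X^+\equiv\mathbb W_G^+$, where $A\equiv B$ means that there is a bijection between the sets $A$ and $B$.
   Context: Let $N^+=\{0,\dots,n\}$, $N=\{1,\dots,n\}$, let $G=(N^+,E)$ be a connected undirected simple graph and $\tilde G=(N^+,\tilde E)$ a directed graph obtained by arbitrarily orienting its edges, $m=|\tilde E|$. Each line has nonzero complex admittance $y_{jk}=y_{kj}$ and impedance $z_{jk}=1/y_{jk}$. For complex numbers, $a\le b$ means inequality of both real and imaginary parts. Given are bounds $\underline v_j\le\overline v_j$ with $\underline v_j>0$ and complex bounds $\underline s_j,\overline s_j$ (possibly infinite), $j\in N^+$; for the slack bus $\underline v_0=\overline v_0=1$ and the bounds on $s_0$ are infinite (no constraint). For $x=(S,\ell,v,s)\in\mathbb R^{3(m+n+1)}$ ($S\in\mathbb C^m$ and $s\in\mathbb C^{n+1}$ regarded as real vectors, $\ell\in\mathbb R^m$, $v\in\mathbb R^{n+1}$) consider (a) $\sum_{k:j\to k}S_{jk}=\sum_{i:i\to j}(S_{ij}-z_{ij}\ell_{ij})+s_j$, $j\in N^+$; (b) $v_j-v_k=2\operatorname{Re}(z_{jk}^HS_{jk})-|z_{jk}|^2\ell_{jk}$, $j\to k\in\tilde E$; (c) $v_j\ell_{jk}=|S_{jk}|^2$, $j\to k\in\tilde E$; (c') $v_j\ell_{jk}\ge|S_{jk}|^2$, $j\to k\in\tilde E$; (d) $\underline v_j\le v_j\le\overline v_j$ and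 $\underline s_j\le s_j\le\overline s_j$, $j\in N^+$; (e) there exists $\theta\in\mathbb R^n$ with $B\theta=\beta(x)\mod 2\pi$ (componentwise), where $\beta_{jk}(x)=\angle(v_j-z_{jk}^HS_{jk})$ for $j\to k\in\tilde E$, and $B$ is the $m\times n$ reduced incidence matrix: for $l\in\tilde E$, $j\in N$, $B_{lj}=1$ if $l$ leaves $j$, $-1$ if $l$ enters $j$, $0$ otherwise. $\mathbb X_{nc}$ is the set of $x$ satisfying (a),(b),(c),(d); $\mathbb X$ the set of $x$ satisfying (a),(b),(c),(d),(e); $\mathbb X^+$ the set of $x$ satisfying (a),(b),(c'),(d). A Hermitian partial matrix $W_G$ on $G$ is a collection of complex numbers $[W_G]_{jj}$ ($j\in N^+$) and $[W_G]_{jk}=[W_G]_{kj}^H$ ($(j,k)\in E$), with real diagonal entries; $W_G(j,k)$ is the $2\times2$ matrix with rows $([W_G]_{jj},[W_G]_{jk})$ and $([W_G]_{kj},[W_G]_{kk})$. Consider (i) for all $j\in N^+$, $\underline s_j\le\sum_{k:(j,k)\in E}y_{jk}^H([W_G]_{jj}-[W_G]_{jk})\le\overline s_j$ and $\underline v_j\le[W_G]_{jj}\le\overline v_j$; (ii) $W_G(j,k)\succeq0$ for all $(j,k)\in E$; (iii) $\operatorname{rank}W_G(j,k)=1$ for all $(j,k)\in E$; (iv) cycle condition: for every cycle $c$ of $G$, $\sum_{(j,k)\in c}\angle[W_G]_{jk}=0\mod 2\pi$, edges traversed in the direction of the cycle. $\mathbb W_G^+$ is the set of Hermitian partial matrices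 on $G$ satisfying (i),(ii); $\mathbb W_{nc}$ those satisfying (i),(ii),(iii); $\mathbb W_G$ those satisfying (i),(ii),(iii),(iv). *)

theory Defs
  imports
    "HOL-Analysis.Analysis"
    "HOL-Library.Real_Mod"
    "Graph_Theory.Graph_Theory"
begin

text \<open>
  A simple undirected graph is a symmetric loop-free digraph (\<open>pair_graph\<close>): each undirected
  edge appears in \<open>parcs (grid P)\<close> as the two arcs \<open>(j, k)\<close> and \<open>(k, j)\<close>.
  The field \<open>lines\<close> is the arc set of the chosen orientation.
  A bound on a complex number is the pair of its (possibly infinite) real and imaginary parts.
\<close>

record network =
  nbus :: nat
  grid :: "nat pair_pre_digraph"
  lines :: "(nat \<times> nat) set"
  admittance :: "nat \<Rightarrow> nat \<Rightarrow> complex"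
  vmin :: "nat \<Rightarrow> real"
  vmax :: "nat \<Rightarrow> real"
  smin :: "nat \<Rightarrow> ereal \<times> ereal"
  smax :: "nat \<Rightarrow> ereal \<times> ereal"

abbreviation edges :: "network \<Rightarrow> (nat \<times> nat) set" where
  "edges P \<equiv> parcs (grid P)"

locale power_network =
  fixes P :: network
  assumes simple_grid: "pair_graph (grid P)"
    and buses: "pverts (grid P) = {0..nbus P}"
    and connected_grid: "Digraph_Component.connected (with_proj (grid P))"
    and lines_subset: "lines P \<subseteq> edges P"
    and lines_orient: "\<And>j k. (j, k) \<in> edges P \<Longrightarrow> (j, k) \<in> lines P \<longleftrightarrow> (k, j) \<notin> lines P"
    and admittance_nonzero: "\<And>j k. (j, k) \<in> edges P \<Longrightarrow> admittance P j k \<noteq> 0"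
    and admittance_sym: "\<And>j k. (j, k) \<in> edges P \<Longrightarrow> admittance P j k = admittance P k j"
    and vmin_pos: "\<And>j. j \<in> {0..nbus P} \<Longrightarrow> 0 < vmin P j"
    and vmin_le_vmax: "\<And>j. j \<in> {0..nbus P} \<Longrightarrow> vmin P j \<le> vmax P j"
    and slack_voltage: "vmin P 0 = 1" "vmax P 0 = 1"
    and slack_injection: "smin P 0 = (-\<infinity>, -\<infinity>)" "smax P 0 = (\<infinity>, \<infinity>)"

definition impedance :: "network \<Rightarrow> nat \<Rightarrow> nat \<Rightarrow> complex" where
  "impedance P j k = 1 / admittance P j k"

definition within_bounds :: "ereal \<times> ereal \<Rightarrow> complex \<Rightarrow> ereal \<times> ereal \<Rightarrow> bool" where
  "within_bounds lo s hi \<longleftrightarrow>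
     fst lo \<le> ereal (Re s) \<and> ereal (Re s) \<le> fst hi \<and>
     snd lo \<le> ereal (Im s) \<and> ereal (Im s) \<le> snd hi"


section \<open>Branch flow model\<close>

record branch_vars =
  flow :: "nat \<times> nat \<Rightarrow> complex"
  current :: "nat \<times> nat \<Rightarrow> real"
  voltage :: "nat \<Rightarrow> real"
  injection :: "nat \<Rightarrow> complex"

text \<open>Vectors are functions that are \<open>undefined\<close> outside their index sets, so that each vector
  has exactly one representative. The field \<open>voltage\<close> holds squared voltage magnitudes and
  \<open>current\<close> squared current magnitudes.\<close>

definition branch_space :: "network \<Rightarrow> branch_vars set" where
  "branch_space P = {x.
     flow x \<in> lines P \<rightarrow>\<^sub>E UNIV \<and> current x \<in> lines P \<rightarrow>\<^sub>E UNIV \<and>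
     voltage x \<in> {0..nbus P} \<rightarrow>\<^sub>E UNIV \<and> injection x \<in> {0..nbus P} \<rightarrow>\<^sub>E UNIV}"

definition power_balance :: "network \<Rightarrow> branch_vars \<Rightarrow> bool" where
  "power_balance P x \<longleftrightarrow> (\<forall>j\<in>{0..nbus P}.
     (\<Sum>k\<in>{k. (j, k) \<in> lines P}. flow x (j, k)) =
     (\<Sum>i\<in>{i. (i, j) \<in> lines P}.
        flow x (i, j) - impedance P i j * complex_of_real (current x (i, j))) + injection x j)"

definition voltage_drop :: "network \<Rightarrow> branch_vars \<Rightarrow> bool" where
  "voltage_drop P x \<longleftrightarrow> (\<forall>(j, k)\<in>lines P.
     voltage x j - voltage x k =
     2 * Re (cnj (impedance P j k) * flow x (j, k)) - (cmod (impedance P j k))\<^sup>2 * current x (j, k))"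

definition current_eq :: "network \<Rightarrow> branch_vars \<Rightarrow> bool" where
  "current_eq P x \<longleftrightarrow> (\<forall>(j, k)\<in>lines P. voltage x j * current x (j, k) = (cmod (flow x (j, k)))\<^sup>2)"

definition current_ge :: "network \<Rightarrow> branch_vars \<Rightarrow> bool" where
  "current_ge P x \<longleftrightarrow> (\<forall>(j, k)\<in>lines P. voltage x j * current x (j, k) \<ge> (cmod (flow x (j, k)))\<^sup>2)"

definition branch_bounds :: "network \<Rightarrow> branch_vars \<Rightarrow> bool" where
  "branch_bounds P x \<longleftrightarrow> (\<forall>j\<in>{0..nbus P}.
     vmin P j \<le> voltage x j \<and> voltage x j \<le> vmax P j \<and>
     within_bounds (smin P j) (injection x j) (smax P j))"

definition incidence :: "nat \<times> nat \<Rightarrow> nat \<Rightarrow> real" where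
  "incidence l j = (if j = fst l then 1 else if j = snd l then -1 else 0)"

definition line_angle :: "network \<Rightarrow> branch_vars \<Rightarrow> nat \<times> nat \<Rightarrow> real" where
  "line_angle P x = (\<lambda>(j, k).
     Arg (complex_of_real (voltage x j) - cnj (impedance P j k) * flow x (j, k)))"

text \<open>The sum ranges over the non-slack buses only: bus 0 has no column in the reduced
  incidence matrix.\<close>

definition angle_recovery :: "network \<Rightarrow> branch_vars \<Rightarrow> bool" where
  "angle_recovery P x \<longleftrightarrow> (\<exists>\<theta> :: nat \<Rightarrow> real. \<forall>l\<in>lines P.
     [(\<Sum>j\<in>{1..nbus P}. incidence l j * \<theta> j) = line_angle P x l] (rmod (2 * pi)))"

definition X_nc :: "network \<Rightarrow> branch_vars set" where
  "X_nc P = {x \<in> branch_space P.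
     power_balance P x \<and> voltage_drop P x \<and> current_eq P x \<and> branch_bounds P x}"

definition X_opf :: "network \<Rightarrow> branch_vars set" where
  "X_opf P = {x \<in> branch_space P.
     power_balance P x \<and> voltage_drop P x \<and> current_eq P x \<and> branch_bounds P x \<and>
     angle_recovery P x}"

definition X_plus :: "network \<Rightarrow> branch_vars set" where
  "X_plus P = {x \<in> branch_space P.
     power_balance P x \<and> voltage_drop P x \<and> current_ge P x \<and> branch_bounds P x}"


section \<open>Bus injection model\<close>

definition partial_index :: "network \<Rightarrow> (nat \<times> nat) set" where
  "partial_index P = {(j, j) | j. j \<in> {0..nbus P}} \<union> edges P"

definition hermitian_partial :: "network \<Rightarrow> (nat \<times> nat \<Rightarrow> complex) set" where
  "hermitian_partial P = {W \<in> partial_index P \<rightarrow>\<^sub>E UNIV.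
     (\<forall>j\<in>{0..nbus P}. Im (W (j, j)) = 0) \<and> (\<forall>(j, k)\<in>edges P. W (j, k) = cnj (W (k, j)))}"

definition edge_matrix :: "(nat \<times> nat \<Rightarrow> complex) \<Rightarrow> nat \<Rightarrow> nat \<Rightarrow> complex ^ 2 ^ 2" where
  "edge_matrix W j k = vector [vector [W (j, j), W (j, k)], vector [W (k, j), W (k, k)]]"

definition psd :: "complex ^ 'n ^ 'n \<Rightarrow> bool" where
  "psd M \<longleftrightarrow> (\<forall>i j. M $ i $ j = cnj (M $ j $ i)) \<and>
     (\<forall>u :: complex ^ 'n. 0 \<le> Re (\<Sum>i\<in>UNIV. \<Sum>j\<in>UNIV. cnj (u $ i) * M $ i $ j * u $ j))"

definition bus_bounds :: "network \<Rightarrow> (nat \<times> nat \<Rightarrow> complex) \<Rightarrow> bool" where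
  "bus_bounds P W \<longleftrightarrow> (\<forall>j\<in>{0..nbus P}.
     within_bounds (smin P j)
       (\<Sum>k\<in>{k. (j, k) \<in> edges P}. cnj (admittance P j k) * (W (j, j) - W (j, k))) (smax P j) \<and>
     vmin P j \<le> Re (W (j, j)) \<and> Re (W (j, j)) \<le> vmax P j)"

definition edges_psd :: "network \<Rightarrow> (nat \<times> nat \<Rightarrow> complex) \<Rightarrow> bool" where
  "edges_psd P W \<longleftrightarrow> (\<forall>(j, k)\<in>edges P. psd (edge_matrix W j k))"

definition edges_rank1 :: "network \<Rightarrow> (nat \<times> nat \<Rightarrow> complex) \<Rightarrow> bool" where
  "edges_rank1 P W \<longleftrightarrow> (\<forall>(j, k)\<in>edges P. rank (edge_matrix W j k) = 1)"

text \<open>In a symmetric digraph \<open>[(j, k), (k, j)]\<close> counts as a cycle; the length condition leaves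
  exactly the cycles of the undirected simple graph.\<close>

definition cycle_condition :: "network \<Rightarrow> (nat \<times> nat \<Rightarrow> complex) \<Rightarrow> bool" where
  "cycle_condition P W \<longleftrightarrow>
     (\<forall>c. pre_digraph.cycle (with_proj (grid P)) c \<and> 3 \<le> length c \<longrightarrow>
        [(\<Sum>e\<leftarrow>c. Arg (W e)) = 0] (rmod (2 * pi)))"

definition W_plus :: "network \<Rightarrow> (nat \<times> nat \<Rightarrow> complex) set" where
  "W_plus P = {W \<in> hermitian_partial P. bus_bounds P W \<and> edges_psd P W}"

definition W_nc :: "network \<Rightarrow> (nat \<times> nat \<Rightarrow> complex) set" where
  "W_nc P = {W \<in> hermitian_partial P. bus_bounds P W \<and> edges_psd P W \<and> edges_rank1 P W}"

definition W_opf :: "network \<Rightarrow> (nat \<times> nat \<Rightarrow> complex) set" where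
  "W_opf P = {W \<in> hermitian_partial P.
     bus_bounds P W \<and> edges_psd P W \<and> edges_rank1 P W \<and> cycle_condition P W}"

end

theory Submission
  imports Defs
begin

text \<open>
  On the linear level (power balance and voltage drop only) a branch flow vector and a Hermitian
  partial matrix carry the same information: \<open>W\<^sub>j\<^sub>j = v\<^sub>j\<close> and \<open>W\<^sub>j\<^sub>k = v\<^sub>j - z\<^sub>j\<^sub>k\<^sup>H S\<^sub>j\<^sub>k\<close> along
  \<open>j \<rightarrow> k\<close>, with inverse \<open>S\<^sub>j\<^sub>k = y\<^sub>j\<^sub>k\<^sup>H (W\<^sub>j\<^sub>j - W\<^sub>j\<^sub>k)\<close> and
  \<open>\<ell>\<^sub>j\<^sub>k = |y\<^sub>j\<^sub>k|\<^sup>2 (W\<^sub>j\<^sub>j + W\<^sub>k\<^sub>k - W\<^sub>j\<^sub>k - W\<^sub>k\<^sub>j)\<close>. One and the same map yields all three bijections.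
  As \<open>|z\<^sub>j\<^sub>k|\<^sup>2 (v\<^sub>j \<ell>\<^sub>j\<^sub>k - |S\<^sub>j\<^sub>k|\<^sup>2) = W\<^sub>j\<^sub>j W\<^sub>k\<^sub>k - |W\<^sub>j\<^sub>k|\<^sup>2\<close> and the diagonal is positive,
  semidefiniteness and rank one of the edge matrices become the inequality and the equality for
  the current. Finally \<open>\<beta>\<^sub>j\<^sub>k\<close> is the angle of \<open>W\<^sub>j\<^sub>k\<close>, and angles on the arcs of a connected graph
  are differences of a potential modulo \<open>2\<pi>\<close> iff they sum to zero around every cycle.
\<close>

section \<open>Two by two matrices\<close>

text \<open>Completing the square: \<open>a\<close> times the quadratic form is
  \<open>|a x + w y|^2\<close> plus the determinant times \<open>|y|^2\<close>. Since
  \<open>a\<close> is positive, the sign of the form is that of this multiple.\<close>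

lemma psd_2_iff:
  fixes a b :: real and w :: complex
  assumes "0 < a"
  shows "psd (vector [vector [of_real a, w], vector [cnj w, of_real b]] :: complex^2^2)
    \<longleftrightarrow> (cmod w)\<^sup>2 \<le> a * b" (is "psd ?M \<longleftrightarrow> _")
proof -
  have form: "Re (\<Sum>i\<in>UNIV. \<Sum>j\<in>UNIV. cnj (u $ i) * ?M $ i $ j * u $ j)
      = a * (cmod (u $ 1))\<^sup>2 + b * (cmod (u $ 2))\<^sup>2 + 2 * Re (cnj (u $ 1) * w * u $ 2)"
    for u :: "complex^2"
    unfolding cmod_power2 by (simp add: UNIV_2 algebra_simps power2_eq_square)
  have square: "a * (a * (cmod x)\<^sup>2 + b * (cmod y)\<^sup>2 + 2 * Re (cnj x * w * y))
      = (cmod (a * x + w * y))\<^sup>2 + (a * b - (cmod w)\<^sup>2) * (cmod y)\<^sup>2" for x y :: complex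
    unfolding cmod_power2 by (simp add: algebra_simps power2_eq_square)
  have herm: "\<forall>i j. ?M $ i $ j = cnj (?M $ j $ i)"
    by (simp add: forall_2)
  show ?thesis
  proof
    assume "psd ?M"
    \<comment> \<open>This vector makes the square \<open>|a x + w y|^2\<close> vanish, so that the
      form takes the value \<open>a\<close> times the determinant.\<close>
    define u :: "complex^2" where "u = vector [-w, of_real a]"
    have "0 \<le> a * (cmod (u $ 1))\<^sup>2 + b * (cmod (u $ 2))\<^sup>2 + 2 * Re (cnj (u $ 1) * w * u $ 2)"
      using \<open>psd ?M\<close> unfolding psd_def form by blast
    then have "0 \<le> a * (a * b - (cmod w)\<^sup>2)"
      unfolding cmod_power2 by (simp add: u_def algebra_simps power2_eq_square)
    then show "(cmod w)\<^sup>2 \<le> a * b"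
      using assms by (simp add: zero_le_mult_iff)
  next
    assume le: "(cmod w)\<^sup>2 \<le> a * b"
    have "0 \<le> a * (cmod x)\<^sup>2 + b * (cmod y)\<^sup>2 + 2 * Re (cnj x * w * y)" (is "0 \<le> ?F") for x y
    proof -
      have "0 \<le> a * ?F"
        using le by (subst square) simp
      then show ?thesis
        using assms by (simp only: zero_le_mult_iff) linarith
    qed
    then show "psd ?M"
      unfolding psd_def form using herm by blast
  qed
qed

text \<open>The first row is nonzero and spans a line. The rank is one exactly when the second row
  lies on that line, that is, when the determinant vanishes.\<close>

lemma rank_2_eq_1_iff:
  fixes a b c d :: "'a :: field"
  assumes "a \<noteq> 0"
  shows "rank (vector [vector [a, b], vector [c, d]] :: 'a^2^2) = 1 \<longleftrightarrow> a * d = b * c"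
    (is "rank ?M = 1 \<longleftrightarrow> _")
proof -
  let ?r = "vector [a, b] :: 'a^2" and ?s = "vector [c, d] :: 'a^2"
  have rows: "rows ?M = {?s, ?r}"
  proof -
    have "rows ?M = range (($) ?M)"
      by (auto simp: rows_def row_def)
    then show ?thesis
      by (simp add: UNIV_2 insert_commute)
  qed
  have "?r \<noteq> 0"
    using assms by (simp add: vec_eq_iff forall_2)
  then have "vec.dim {?r} = 1"
    by (simp add: vec.dim_insert)
  moreover have "?s \<in> vec.span {?r} \<longleftrightarrow> a * d = b * c"
  proof
    assume "?s \<in> vec.span {?r}"
    then obtain k where "?s = k *s ?r"
      by (auto simp: vec.span_singleton)
    then have "c = k * a" "d = k * b"
      by (simp_all add: vec_eq_iff forall_2)
    then show "a * d = b * c" by simp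
  next
    assume "a * d = b * c"
    then have "?s = (c / a) *s ?r"
      using assms by (simp add: vec_eq_iff forall_2 field_simps)
    then show "?s \<in> vec.span {?r}"
      by (metis vec.span_base vec.span_scale singletonI)
  qed
  ultimately show ?thesis
    by (simp add: row_rank_def_gen rows vec.dim_insert)
qed

section \<open>Potentials and cycles\<close>

context pair_graph
begin

text \<open>Strong induction on the length: a closed walk either is a cycle or contains a closed
  subwalk avoiding its first arc, and cutting that out leaves two shorter closed walks. Equations
  between values of \<open>cis\<close> express congruence modulo 2 pi.\<close>

lemma closed_walk_sum_trivial:
  fixes a :: "'a \<times> 'a \<Rightarrow> real"
  assumes antisym: "\<And>j k. (j, k) \<in> parcs G \<Longrightarrow> cis (a (j, k)) * cis (a (k, j)) = 1"
    and cycles: "\<And>c. cycle c \<Longrightarrow> 3 \<le> length c \<Longrightarrow> cis (\<Sum>e\<leftarrow>c. a e) = 1"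
    and "awalk u p u"
  shows "cis (\<Sum>e\<leftarrow>p. a e) = 1"
  using \<open>awalk u p u\<close>
proof (induction "length p" arbitrary: u p rule: less_induct)
  case less
  show ?case
  proof (cases p)
    case Nil
    then show ?thesis by simp
  next
    case (Cons e p')
    then have e: "e \<in> parcs G" "fst e = u" and p': "awalk (snd e) p' u"
      using less.prems by (auto simp: awalk_Cons_iff)
    show ?thesis
    \<comment> \<open>The definition of a cycle lets the start vertex recur at the end, so
      distinctness concerns the vertices after the first arc only.\<close>
    proof (cases "distinct (pawalk_verts (snd e) p')")
      case True
      then have "cycle p"
        using less.prems Cons by (auto simp: cycle_def intro!: exI[of _ u])
      \<comment> \<open>The assumption on cycles covers length at least three. A cycle of length one
        would be a loop, and one of length two runs along an arc and back, where
        \<open>antisym\<close> applies.\<close>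
      consider "length p = 1" | "length p = 2" | "3 \<le> length p"
        using Cons by (cases p') (auto simp: Suc_le_eq)
      then show ?thesis
      proof cases
        case 1
        then show ?thesis
          using Cons e p' pair_no_loops[of e] by (auto simp: awalk_Nil_iff)
      next
        case 2
        then obtain f where "p' = [f]"
          using Cons by (cases p') auto
        then have "p = [(u, snd e), (snd e, u)]"
          using Cons e p' by (auto simp: awalk_Cons_iff awalk_Nil_iff prod_eq_iff)
        then show ?thesis
          using antisym[of u "snd e"] e by (auto simp: cis_mult)
      next
        case 3
        with \<open>cycle p\<close> show ?thesis by (rule cycles)
      qed
    next
      case False
      then obtain q r s w where dec: "p' = q @ r @ s" "awalk (snd e) q w" "awalk w r w"
          "awalk w s u" "closed_w r"
        using awalk_cyc_decompE'[OF p'] by metis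
      \<comment> \<open>Removing \<open>r\<close> shortens the walk because \<open>r\<close> is
        nonempty, and \<open>r\<close> itself is shorter because it misses \<open>e\<close>.\<close>
      have "awalk u (e # q @ s) u"
        using dec e less.prems Cons by (auto simp: awalk_Cons_iff awalk_append_iff)
      moreover have "0 < length r"
        using dec by (simp add: closed_w_def)
      ultimately have "cis (\<Sum>e\<leftarrow>e # q @ s. a e) = 1" "cis (\<Sum>e\<leftarrow>r. a e) = 1"
        using less.hyps[of "e # q @ s" u] less.hyps[of r w] dec Cons by simp_all
      moreover have "(\<Sum>e\<leftarrow>p. a e) = (\<Sum>e\<leftarrow>e # q @ s. a e) + (\<Sum>e\<leftarrow>r. a e)"
        using Cons dec by simp
      ultimately show ?thesis
        by (simp flip: cis_mult)
    qed
  qed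
qed

text \<open>The potential of a vertex is the sum along a walk to a fixed root; modulo 2 pi it does
  not depend on the walk, since closed walks sum to zero. Conversely, potential differences
  telescope along walks.\<close>

lemma cycle_condition_iff_potential:
  fixes a :: "'a \<times> 'a \<Rightarrow> real"
  assumes conn: "connected G"
    and antisym: "\<And>j k. (j, k) \<in> parcs G \<Longrightarrow> cis (a (j, k)) * cis (a (k, j)) = 1"
  shows "(\<forall>c. cycle c \<and> 3 \<le> length c \<longrightarrow> cis (\<Sum>e\<leftarrow>c. a e) = 1) \<longleftrightarrow>
    (\<exists>\<phi>. \<forall>(j, k)\<in>parcs G. cis (a (j, k)) = cis (\<phi> j - \<phi> k))" (is "?L \<longleftrightarrow> ?R")
proof
  assume cycles: ?L
  have closed: "cis (\<Sum>e\<leftarrow>p. a e) = 1" if "awalk u p u" for u p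
    by (rule closed_walk_sum_trivial[where a = a, OF _ _ that]) (simp_all add: antisym cycles)
  have sc: "strongly_connected G"
    using conn symmetric_connected_imp_strongly_connected pair_sym_arcs by blast
  then obtain r where r: "r \<in> pverts G"
    by (auto simp: strongly_connected_def)
  have reach: "\<exists>p. awalk u p v" if "u \<in> pverts G" "v \<in> pverts G" for u v
    using sc that by (auto simp: strongly_connected_def reachable_awalk)
  define w where "w v = (SOME p. awalk v p r)" for v
  have w: "awalk v (w v) r" if "v \<in> pverts G" for v
    using reach[OF that r] someI_ex[of "\<lambda>p. awalk v p r"] by (simp add: w_def)
  have "cis (a (j, k)) = cis ((\<Sum>e\<leftarrow>w j. a e) - (\<Sum>e\<leftarrow>w k. a e))" if jk: "(j, k) \<in> parcs G" for j k
  proof -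
    have "j \<in> pverts G" "k \<in> pverts G"
      using jk in_arcsD1 in_arcsD2 by auto
    \<comment> \<open>A common return path from the root closes both the chosen walk of
      \<open>j\<close> and the detour through \<open>k\<close>. Its contribution cancels when the
      two closed walks are compared.\<close>
    moreover from this obtain q where q: "awalk r q j"
      using reach r by blast
    ultimately have "awalk j (w j @ q) j" "awalk j ((j, k) # w k @ q) j"
      using w jk by (auto simp: awalk_append_iff awalk_Cons_iff)
    then have "cis (\<Sum>e\<leftarrow>w j @ q. a e) = 1" "cis (\<Sum>e\<leftarrow>(j, k) # w k @ q. a e) = 1"
      by (blast intro: closed)+
    then have "cis (\<Sum>e\<leftarrow>w j. a e) * cis (\<Sum>e\<leftarrow>q. a e) =
        cis (a (j, k)) * cis (\<Sum>e\<leftarrow>w k. a e) * cis (\<Sum>e\<leftarrow>q. a e)"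
      by (simp add: cis_mult add.assoc)
    then show ?thesis
      by (simp flip: cis_divide)
  qed
  then show ?R
    by (intro exI[of _ "\<lambda>v. \<Sum>e\<leftarrow>w v. a e"]) auto
next
  assume ?R
  then obtain \<phi> where \<phi>: "\<And>j k. (j, k) \<in> parcs G \<Longrightarrow> cis (a (j, k)) = cis (\<phi> j - \<phi> k)"
    by auto
  have "cis (\<Sum>e\<leftarrow>p. a e) = cis (\<phi> u - \<phi> v)" if "awalk u p v" for u p v
    using that
  proof (induction p arbitrary: u)
    case (Cons e p)
    then have "cis (a e) = cis (\<phi> u - \<phi> (snd e))" "cis (\<Sum>e\<leftarrow>p. a e) = cis (\<phi> (snd e) - \<phi> v)"
      using \<phi>[of "fst e" "snd e"] by (auto simp: awalk_Cons_iff)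
    then show ?case
      by (simp flip: cis_mult) (simp add: cis_mult)
  qed (simp add: awalk_Nil_iff)
  then show ?L
    by (fastforce simp: cycle_def)
qed

end

section \<open>Branch flows as partial matrices\<close>

text \<open>In terms of complex bus voltages the entry at \<open>(j, k)\<close> stands for
  \<open>V_j V_k^H\<close>: Ohm's law \<open>V_k = V_j - z I\<close> with \<open>S = V_j I^H\<close>
  gives \<open>v_j - z^H S\<close>. Conjugating against the orientation makes the matrix Hermitian
  for every \<open>x\<close>.\<close>

definition partial_matrix :: "network \<Rightarrow> branch_vars \<Rightarrow> nat \<times> nat \<Rightarrow> complex" where
  "partial_matrix P x = (\<lambda>(j, k)\<in>partial_index P.
     if j = k then of_real (voltage x j)
     else if (j, k) \<in> lines P then voltage x j - cnj (impedance P j k) * flow x (j, k)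
     else cnj (voltage x k - cnj (impedance P k j) * flow x (k, j)))"

definition bus_injection :: "network \<Rightarrow> (nat \<times> nat \<Rightarrow> complex) \<Rightarrow> nat \<Rightarrow> complex" where
  "bus_injection P W j =
     (\<Sum>k\<in>{k. (j, k) \<in> edges P}. cnj (admittance P j k) * (W (j, j) - W (j, k)))"

text \<open>The formula for \<open>current\<close> is \<open>|y (V_j - V_k)|^2\<close> expanded,
  with \<open>W (j, k)\<close> read as \<open>V_j V_k^H\<close>.\<close>

definition branch_vars_of :: "network \<Rightarrow> (nat \<times> nat \<Rightarrow> complex) \<Rightarrow> branch_vars" where
  "branch_vars_of P W = \<lparr>
     flow = (\<lambda>(j, k)\<in>lines P. cnj (admittance P j k) * (W (j, j) - W (j, k))),
     current = (\<lambda>(j, k)\<in>lines P.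
       (cmod (admittance P j k))\<^sup>2 * (Re (W (j, j)) + Re (W (k, k)) - 2 * Re (W (j, k)))),
     voltage = (\<lambda>j\<in>{0..nbus P}. Re (W (j, j))),
     injection = (\<lambda>j\<in>{0..nbus P}. bus_injection P W j)\<rparr>"

context power_network
begin

sublocale pair_graph "grid P"
  by (rule simple_grid)

section \<open>Undirected edges and oriented lines\<close>

lemma edges_sym: "(j, k) \<in> edges P \<Longrightarrow> (k, j) \<in> edges P"
  using pair_sym_arcs by (auto simp: symmetric_def elim: symE)

lemma edge_cases:
  assumes "(j, k) \<in> edges P"
  obtains "(j, k) \<in> lines P" "(k, j) \<notin> lines P" | "(k, j) \<in> lines P" "(j, k) \<notin> lines P"
  using lines_orient[OF assms] by blast

lemma lineD:
  assumes "(j, k) \<in> lines P"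
  shows "(j, k) \<in> edges P" "(k, j) \<in> edges P" "(k, j) \<notin> lines P" "j \<noteq> k"
    "j \<in> {0..nbus P}" "k \<in> {0..nbus P}"
    "impedance P j k \<noteq> 0" "admittance P j k = 1 / impedance P j k"
    "admittance P k j = 1 / impedance P j k"
proof -
  show e: "(j, k) \<in> edges P"
    using assms lines_subset by blast
  show "(k, j) \<in> edges P"
    using e by (rule edges_sym)
  show "(k, j) \<notin> lines P"
    using assms lines_orient[OF e] by simp
  show "j \<noteq> k"
    using pair_no_loops[OF e] by simp
  show "j \<in> {0..nbus P}" "k \<in> {0..nbus P}"
    using in_arcsD1[OF e] in_arcsD2[OF e] buses by auto
  show "impedance P j k \<noteq> 0" "admittance P j k = 1 / impedance P j k"
      "admittance P k j = 1 / impedance P j k"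
    using admittance_nonzero[OF e] admittance_sym[OF e] by (simp_all add: impedance_def)
qed

text \<open>Every neighbour of \<open>j\<close> is joined to it by exactly one line, leaving or
  entering \<open>j\<close>. This matches the neighbour sum of the bus injection model with the two
  sums of \<open>power_balance\<close>.\<close>

lemma sum_edges:
  fixes f :: "nat \<Rightarrow> 'a :: comm_monoid_add"
  shows "(\<Sum>k\<in>{k. (j, k) \<in> edges P}. f k) =
    (\<Sum>k\<in>{k. (j, k) \<in> lines P}. f k) + (\<Sum>i\<in>{i. (i, j) \<in> lines P}. f i)"
proof -
  have split: "{k. (j, k) \<in> edges P} = {k. (j, k) \<in> lines P} \<union> {i. (i, j) \<in> lines P}"
    using lineD(1,2) by (auto elim: edge_cases)
  have "{k. (j, k) \<in> lines P} \<subseteq> {0..nbus P}" "{i. (i, j) \<in> lines P} \<subseteq> {0..nbus P}"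
    using lineD(5,6) by blast+
  then have "finite {k. (j, k) \<in> lines P}" "finite {i. (i, j) \<in> lines P}"
    using finite_atLeastAtMost finite_subset by blast+
  then show ?thesis
    unfolding split using lineD(3) by (intro sum.union_disjoint) auto
qed

section \<open>The linear bijection and its inverse\<close>

lemma partial_matrix_diag:
  "j \<in> {0..nbus P} \<Longrightarrow> partial_matrix P x (j, j) = of_real (voltage x j)"
  by (auto simp: partial_matrix_def partial_index_def)

lemma partial_matrix_line:
  assumes "(j, k) \<in> lines P"
  shows "partial_matrix P x (j, k) = voltage x j - cnj (impedance P j k) * flow x (j, k)"
    and "partial_matrix P x (k, j) = cnj (voltage x j - cnj (impedance P j k) * flow x (j, k))"
  using lineD[OF assms] assms by (auto simp: partial_matrix_def partial_index_def)

lemma partial_matrix_hermitian: "partial_matrix P x \<in> hermitian_partial P"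
proof -
  have "partial_matrix P x (j, k) = cnj (partial_matrix P x (k, j))" if "(j, k) \<in> edges P" for j k
    using that by (cases rule: edge_cases) (simp_all add: partial_matrix_line)
  moreover have "partial_matrix P x \<in> partial_index P \<rightarrow>\<^sub>E UNIV"
    by (simp add: partial_matrix_def)
  ultimately show ?thesis
    by (auto simp: hermitian_partial_def partial_matrix_diag)
qed

lemma partial_matrix_sym:
  assumes "(j, k) \<in> edges P"
  shows "partial_matrix P x (k, j) = cnj (partial_matrix P x (j, k))"
  using edges_sym[OF assms] partial_matrix_hermitian[of x] by (auto simp: hermitian_partial_def)

text \<open>Conditions on edge matrices do not depend on the direction of the edge, so they need
  checking along the orientation only.\<close>

lemma ball_edges_iff_lines:
  assumes "\<And>j k. (j, k) \<in> edges P \<Longrightarrow> Q k j \<longleftrightarrow> Q j k"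
  shows "(\<forall>(j, k)\<in>edges P. Q j k) \<longleftrightarrow> (\<forall>(j, k)\<in>lines P. Q j k)"
  using assms lineD(1) by (blast elim: edge_cases)

text \<open>A leaving line contributes its sending-end power, an entering line the negative of its
  receiving-end power \<open>S - z l\<close>. Power balance then identifies the total with the
  injection.\<close>

lemma bus_injection_partial_matrix:
  assumes "power_balance P x" "voltage_drop P x" "j \<in> {0..nbus P}"
  shows "bus_injection P (partial_matrix P x) j = injection x j"
proof -
  let ?W = "partial_matrix P x"
  have out: "cnj (admittance P j k) * (?W (j, j) - ?W (j, k)) = flow x (j, k)"
    if "(j, k) \<in> lines P" for k
    using lineD[OF that] assms(3) by (simp add: partial_matrix_diag partial_matrix_line that)
  have into: "cnj (admittance P j i) * (?W (j, j) - ?W (j, i)) =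
      - (flow x (i, j) - impedance P i j * complex_of_real (current x (i, j)))"
    if "(i, j) \<in> lines P" for i
  proof -
    let ?z = "impedance P i j"
    have "voltage x i - voltage x j =
        2 * Re (cnj ?z * flow x (i, j)) - (cmod ?z)\<^sup>2 * current x (i, j)"
      using assms(2) that by (auto simp: voltage_drop_def)
    \<comment> \<open>With \<open>u = z^H S\<close> the entry \<open>W (j, i)\<close> is
      \<open>v_i - u^H\<close>. Substituting the voltage drop and \<open>2 Re u = u + u^H\<close>
      leaves \<open>|z|^2 l - u\<close>.\<close>
    then have "?W (j, j) - ?W (j, i) =
        - (cnj ?z * flow x (i, j) - cnj ?z * ?z * complex_of_real (current x (i, j)))"
      using assms(3) that unfolding cmod_power2
      by (simp add: partial_matrix_diag partial_matrix_line complex_eq_iff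
          power2_eq_square algebra_simps)
    then show ?thesis
      using lineD(7)[OF that] by (simp add: lineD(9)[OF that] divide_simps) (simp add: algebra_simps)
  qed
  have "bus_injection P ?W j = (\<Sum>k\<in>{k. (j, k) \<in> lines P}. flow x (j, k)) -
      (\<Sum>i\<in>{i. (i, j) \<in> lines P}.
        flow x (i, j) - impedance P i j * complex_of_real (current x (i, j)))"
    by (simp add: bus_injection_def sum_edges out into sum_negf sum_subtractf)
  then show ?thesis
    using assms(1,3) by (simp add: power_balance_def)
qed

text \<open>The matrix stores only voltages and flows. The voltage drop equation recovers the
  current, power balance the injection.\<close>

lemma branch_vars_of_partial_matrix:
  assumes "x \<in> branch_space P" "power_balance P x" "voltage_drop P x"
  shows "branch_vars_of P (partial_matrix P x) = x"
proof -
  let ?W = "partial_matrix P x"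
  have ext: "flow x \<in> lines P \<rightarrow>\<^sub>E UNIV" "current x \<in> lines P \<rightarrow>\<^sub>E UNIV"
      "voltage x \<in> {0..nbus P} \<rightarrow>\<^sub>E UNIV" "injection x \<in> {0..nbus P} \<rightarrow>\<^sub>E UNIV"
    using assms(1) by (auto simp: branch_space_def)
  have "flow (branch_vars_of P ?W) = flow x"
  proof
    fix e
    show "flow (branch_vars_of P ?W) e = flow x e"
      using ext(1) lineD(5,7,8)[of "fst e" "snd e"]
      by (cases e) (auto simp: branch_vars_of_def partial_matrix_diag partial_matrix_line)
  qed
  moreover have "current (branch_vars_of P ?W) = current x"
  proof
    fix e
    show "current (branch_vars_of P ?W) e = current x e"
    proof (cases "e \<in> lines P")
      case True
      then obtain j k where e: "e = (j, k)" "(j, k) \<in> lines P"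
        by (cases e) auto
      have "voltage x j - voltage x k =
          2 * Re (cnj (impedance P j k) * flow x e) - (cmod (impedance P j k))\<^sup>2 * current x e"
        using assms(3) e by (auto simp: voltage_drop_def)
      then have "Re (?W (j, j)) + Re (?W (k, k)) - 2 * Re (?W (j, k)) =
          (cmod (impedance P j k))\<^sup>2 * current x e"
        using lineD[OF e(2)] e by (simp add: partial_matrix_diag partial_matrix_line)
      then show ?thesis
        using lineD[OF e(2)] e by (simp add: branch_vars_of_def norm_divide power_divide)
    qed (use ext in \<open>auto simp: branch_vars_of_def\<close>)
  qed
  moreover have "voltage (branch_vars_of P ?W) = voltage x"
    using ext(3) by (auto simp: branch_vars_of_def partial_matrix_diag fun_eq_iff)
  moreover have "injection (branch_vars_of P ?W) = injection x"
    using ext(4) bus_injection_partial_matrix[OF assms(2,3)]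
    by (auto simp: branch_vars_of_def fun_eq_iff)
  ultimately show ?thesis
    by simp
qed

text \<open>Along a line the factors \<open>z^H\<close> and \<open>y^H\<close> cancel; against it
  the Hermitian property applies, and outside the index set both sides are
  \<open>undefined\<close>.\<close>

lemma partial_matrix_branch_vars_of:
  assumes "W \<in> hermitian_partial P"
  shows "partial_matrix P (branch_vars_of P W) = W"
proof
  fix e :: "nat \<times> nat"
  have ext: "W \<in> partial_index P \<rightarrow>\<^sub>E UNIV"
    and diag: "\<And>j. j \<in> {0..nbus P} \<Longrightarrow> of_real (Re (W (j, j))) = W (j, j)"
    and herm: "\<And>j k. (j, k) \<in> edges P \<Longrightarrow> W (j, k) = cnj (W (k, j))"
    using assms by (auto simp: hermitian_partial_def complex_eq_iff)
  let ?x = "branch_vars_of P W"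
  have line: "partial_matrix P ?x (j, k) = W (j, k)" "partial_matrix P ?x (k, j) = W (k, j)"
    if "(j, k) \<in> lines P" for j k
  proof -
    have "voltage ?x j - cnj (impedance P j k) * flow ?x (j, k) = W (j, k)"
      using lineD[OF that] that by (simp add: branch_vars_of_def diag)
    then show "partial_matrix P ?x (j, k) = W (j, k)" "partial_matrix P ?x (k, j) = W (k, j)"
      using herm[OF lineD(2)[OF that]] by (simp_all only: partial_matrix_line[OF that])
  qed
  show "partial_matrix P ?x e = W e"
  proof (cases "e \<in> partial_index P")
    case True
    then consider j where "e = (j, j)" "j \<in> {0..nbus P}" | j k where "e = (j, k)" "(j, k) \<in> edges P"
      by (cases e) (auto simp: partial_index_def)
    then show ?thesis
    proof cases
      case 1
      then show ?thesis by (simp add: partial_matrix_diag branch_vars_of_def diag)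
    next
      case 2
      then show ?thesis using line by (auto elim: edge_cases)
    qed
  next
    case False
    then show ?thesis
      using ext by (auto simp: partial_matrix_def)
  qed
qed

lemma branch_vars_of_feasible:
  assumes "W \<in> hermitian_partial P"
  shows "branch_vars_of P W \<in> branch_space P"
    and "power_balance P (branch_vars_of P W)"
    and "voltage_drop P (branch_vars_of P W)"
proof -
  let ?x = "branch_vars_of P W"
  have diag: "\<And>j. j \<in> {0..nbus P} \<Longrightarrow> Im (W (j, j)) = 0"
    and herm: "\<And>j k. (j, k) \<in> edges P \<Longrightarrow> W (j, k) = cnj (W (k, j))"
    using assms by (auto simp: hermitian_partial_def)
  show "?x \<in> branch_space P"
    by (simp add: branch_vars_of_def branch_space_def)
  have into: "flow ?x (i, j) - impedance P i j * complex_of_real (current ?x (i, j)) =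
      - (cnj (admittance P j i) * (W (j, j) - W (j, i)))" if "(i, j) \<in> lines P" for i j
  proof -
    let ?z = "impedance P i j"
    have "W (j, i) = cnj (W (i, j))"
      using herm lineD(2)[OF that] by blast
    \<comment> \<open>The Hermitian property turns the real parts in \<open>current\<close> into
      matrix entries, so that \<open>z l\<close> becomes \<open>y^H\<close> times a combination of
      entries and can be subtracted from the flow.\<close>
    then have "complex_of_real (Re (W (i, i)) + Re (W (j, j)) - 2 * Re (W (i, j))) =
        W (i, i) + W (j, j) - W (i, j) - W (j, i)"
      using diag lineD(5,6)[OF that] by (simp add: complex_eq_iff)
    moreover have "?z * complex_of_real ((cmod (1 / ?z))\<^sup>2) = cnj (1 / ?z)"
      using lineD(7)[OF that] unfolding complex_norm_square by (simp del: complex_cnj_divide)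
    ultimately show ?thesis
      using lineD(8,9)[OF that] that
      by (simp add: branch_vars_of_def mult.assoc[symmetric] del: complex_cnj_divide)
        (simp add: algebra_simps)
  qed
  show "power_balance P ?x"
  proof -
    have "(\<Sum>k\<in>{k. (j, k) \<in> lines P}. flow ?x (j, k)) =
        (\<Sum>k\<in>{k. (j, k) \<in> lines P}. cnj (admittance P j k) * (W (j, j) - W (j, k)))" for j
      by (intro sum.cong) (auto simp: branch_vars_of_def)
    then show ?thesis
      unfolding power_balance_def
      by (simp add: into sum_negf) (simp add: branch_vars_of_def bus_injection_def sum_edges)
  qed
  show "voltage_drop P ?x"
    unfolding voltage_drop_def
  proof safe
    fix j k assume jk: "(j, k) \<in> lines P"
    note D = lineD[OF jk]
    have "cnj (impedance P j k) * flow ?x (j, k) = W (j, j) - W (j, k)"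
      using D jk by (simp add: branch_vars_of_def)
    moreover have "(cmod (impedance P j k))\<^sup>2 * current ?x (j, k) =
        Re (W (j, j)) + Re (W (k, k)) - 2 * Re (W (j, k))"
      using D jk by (simp add: branch_vars_of_def norm_divide power_divide)
    ultimately show "voltage ?x j - voltage ?x k = 2 * Re (cnj (impedance P j k) * flow ?x (j, k)) -
        (cmod (impedance P j k))\<^sup>2 * current ?x (j, k)"
      using D by (simp add: branch_vars_of_def)
  qed
qed

lemma bij_betw_partial_matrix:
  "bij_betw (partial_matrix P) {x \<in> branch_space P. power_balance P x \<and> voltage_drop P x}
     (hermitian_partial P)"
  by (rule bij_betw_byWitness[where f' = "branch_vars_of P"])
    (auto simp: branch_vars_of_partial_matrix partial_matrix_branch_vars_of
      partial_matrix_hermitian branch_vars_of_feasible)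

section \<open>Bounds, semidefiniteness and rank in branch flow terms\<close>

lemma bus_bounds_partial_matrix:
  assumes "power_balance P x" "voltage_drop P x"
  shows "bus_bounds P (partial_matrix P x) \<longleftrightarrow> branch_bounds P x"
  using bus_injection_partial_matrix[OF assms]
  by (auto simp: bus_bounds_def branch_bounds_def bus_injection_def partial_matrix_diag)

text \<open>The right-hand side is the determinant of the edge matrix. Eliminating the current by
  the voltage drop equation reduces the claim to the expansion of \<open>|v_j - u|^2\<close> with
  \<open>u = z^H S\<close>.\<close>

lemma edge_det:
  assumes "voltage_drop P x" "(j, k) \<in> lines P"
  shows "(cmod (impedance P j k))\<^sup>2 * (voltage x j * current x (j, k) - (cmod (flow x (j, k)))\<^sup>2)
    = voltage x j * voltage x k - (cmod (partial_matrix P x (j, k)))\<^sup>2"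
proof -
  define u where "u = cnj (impedance P j k) * flow x (j, k)"
  have "voltage x j - voltage x k = 2 * Re u - (cmod (impedance P j k))\<^sup>2 * current x (j, k)"
    using assms by (auto simp: voltage_drop_def u_def)
  then have drop: "(cmod (impedance P j k))\<^sup>2 * current x (j, k) = voltage x k - voltage x j + 2 * Re u"
    by simp
  have "(cmod (impedance P j k))\<^sup>2 * (cmod (flow x (j, k)))\<^sup>2 = (cmod u)\<^sup>2"
    by (simp add: u_def norm_mult power_mult_distrib)
  then have "(cmod (impedance P j k))\<^sup>2 * (voltage x j * current x (j, k) - (cmod (flow x (j, k)))\<^sup>2)
      = voltage x j * (voltage x k - voltage x j + 2 * Re u) - (cmod u)\<^sup>2"
    unfolding drop[symmetric] by (simp add: algebra_simps)
  also have "\<dots> = voltage x j * voltage x k - (cmod (voltage x j - u))\<^sup>2"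
    unfolding cmod_power2 by (simp add: algebra_simps power2_eq_square)
  finally show ?thesis
    by (simp add: partial_matrix_line[OF assms(2)] u_def)
qed

context
  fixes x
  assumes drop: "voltage_drop P x" and bounds: "branch_bounds P x"
begin

lemma voltage_pos: "j \<in> {0..nbus P} \<Longrightarrow> 0 < voltage x j"
  using bounds vmin_pos unfolding branch_bounds_def by (blast intro: less_le_trans)

lemma cmod_partial_matrix_le_iff:
  assumes "(j, k) \<in> lines P"
  shows "(cmod (partial_matrix P x (j, k)))\<^sup>2 \<le> voltage x j * voltage x k \<longleftrightarrow>
    (cmod (flow x (j, k)))\<^sup>2 \<le> voltage x j * current x (j, k)"
proof -
  have "0 < (cmod (impedance P j k))\<^sup>2"
    using lineD(7)[OF assms] by simp
  then show ?thesis
    using edge_det[OF drop assms] zero_le_mult_iff by (smt (verit, best))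
qed

lemma cmod_partial_matrix_eq_iff:
  assumes "(j, k) \<in> lines P"
  shows "(cmod (partial_matrix P x (j, k)))\<^sup>2 = voltage x j * voltage x k \<longleftrightarrow>
    voltage x j * current x (j, k) = (cmod (flow x (j, k)))\<^sup>2"
proof -
  have "(cmod (impedance P j k))\<^sup>2 \<noteq> 0"
    using lineD(7)[OF assms] by simp
  then show ?thesis
    using edge_det[OF drop assms] by (metis eq_iff_diff_eq_0 mult_eq_0_iff)
qed

lemma edge_matrix_partial_matrix:
  assumes "(j, k) \<in> edges P"
  shows "edge_matrix (partial_matrix P x) j k =
    vector [vector [of_real (voltage x j), partial_matrix P x (j, k)],
            vector [cnj (partial_matrix P x (j, k)), of_real (voltage x k)]]"
  using in_arcsD1[OF assms] in_arcsD2[OF assms]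
  by (simp add: edge_matrix_def buses partial_matrix_diag partial_matrix_sym[OF assms])

text \<open>The voltage bounds make the diagonal positive, so semidefiniteness is nonnegativity of
  the determinant, which by \<open>edge_det\<close> is a positive multiple of the slack in the
  current inequality.\<close>

lemma edges_psd_iff: "edges_psd P (partial_matrix P x) \<longleftrightarrow> current_ge P x"
proof -
  have "psd (edge_matrix (partial_matrix P x) j k) \<longleftrightarrow>
      (cmod (partial_matrix P x (j, k)))\<^sup>2 \<le> voltage x j * voltage x k" if "(j, k) \<in> edges P" for j k
    using in_arcsD1[OF that] buses
    by (simp add: edge_matrix_partial_matrix[OF that] psd_2_iff voltage_pos)
  then have "edges_psd P (partial_matrix P x) \<longleftrightarrow>
      (\<forall>(j, k)\<in>edges P. (cmod (partial_matrix P x (j, k)))\<^sup>2 \<le> voltage x j * voltage x k)"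
    unfolding edges_psd_def by blast
  also have "\<dots> \<longleftrightarrow>
      (\<forall>(j, k)\<in>lines P. (cmod (partial_matrix P x (j, k)))\<^sup>2 \<le> voltage x j * voltage x k)"
    by (rule ball_edges_iff_lines) (simp add: partial_matrix_sym mult.commute)
  finally show ?thesis
    using cmod_partial_matrix_le_iff by (auto simp: current_ge_def)
qed

lemma edges_rank1_iff: "edges_rank1 P (partial_matrix P x) \<longleftrightarrow> current_eq P x"
proof -
  have "rank (edge_matrix (partial_matrix P x) j k) = 1 \<longleftrightarrow>
      (cmod (partial_matrix P x (j, k)))\<^sup>2 = voltage x j * voltage x k" if "(j, k) \<in> edges P" for j k
  proof -
    have "complex_of_real (voltage x j) \<noteq> 0"
      using in_arcsD1[OF that] buses voltage_pos by fastforce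
    then show ?thesis
      unfolding edge_matrix_partial_matrix[OF that]
      by (subst rank_2_eq_1_iff) (auto simp flip: complex_norm_square of_real_mult of_real_power)
  qed
  then have "edges_rank1 P (partial_matrix P x) \<longleftrightarrow>
      (\<forall>(j, k)\<in>edges P. (cmod (partial_matrix P x (j, k)))\<^sup>2 = voltage x j * voltage x k)"
    unfolding edges_rank1_def by blast
  also have "\<dots> \<longleftrightarrow>
      (\<forall>(j, k)\<in>lines P. (cmod (partial_matrix P x (j, k)))\<^sup>2 = voltage x j * voltage x k)"
    by (rule ball_edges_iff_lines) (simp add: partial_matrix_sym mult.commute)
  finally show ?thesis
    using cmod_partial_matrix_eq_iff by (auto simp: current_eq_def)
qed

text \<open>The current equation forces \<open>|W_jk|^2 = v_j v_k > 0\<close>. Hence the entries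
  have genuine angles, with \<open>cis (Arg w)\<close> equal to \<open>sgn w\<close>.\<close>

lemma partial_matrix_nonzero:
  assumes "current_eq P x" "(j, k) \<in> edges P"
  shows "partial_matrix P x (j, k) \<noteq> 0"
proof -
  have "partial_matrix P x (j, k) \<noteq> 0 \<and> partial_matrix P x (k, j) \<noteq> 0" if "(j, k) \<in> lines P" for j k
  proof -
    have "(cmod (partial_matrix P x (j, k)))\<^sup>2 = voltage x j * voltage x k"
      using assms(1) that cmod_partial_matrix_eq_iff by (auto simp: current_eq_def)
    moreover have "0 < voltage x j * voltage x k"
      using lineD(5,6)[OF that] voltage_pos by simp
    ultimately show ?thesis
      using partial_matrix_sym[OF lineD(1)[OF that]] by auto
  qed
  then show ?thesis
    using assms(2) by (auto elim: edge_cases)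
qed

end

section \<open>Angle recovery and the cycle condition\<close>

lemma angle_recovery_iff_potential:
  "angle_recovery P x \<longleftrightarrow>
    (\<exists>\<phi>. \<forall>(j, k)\<in>lines P. cis (Arg (partial_matrix P x (j, k))) = cis (\<phi> j - \<phi> k))"
proof -
  \<comment> \<open>Leaving out the column of bus 0 amounts to giving that bus the angle zero,
    whatever value the function has there.\<close>
  have incidence_sum: "(\<Sum>i\<in>{1..nbus P}. incidence (j, k) i * \<theta> i) = \<theta>' j - \<theta>' k"
    if "(j, k) \<in> lines P" "\<theta>' = \<theta>(0 := 0)" for j k and \<theta> \<theta>' :: "nat \<Rightarrow> real"
  proof -
    have "(\<Sum>i\<in>{1..nbus P}. incidence (j, k) i * \<theta> i) =
        (\<Sum>i\<in>{1..nbus P}. (if i = j then \<theta> i else 0) - (if i = k then \<theta> i else 0))"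
      using lineD(4)[OF that(1)] by (intro sum.cong) (auto simp: incidence_def)
    then show ?thesis
      using lineD(5,6)[OF that(1)] that(2) by (auto simp: sum_subtractf)
  qed
  have angle: "line_angle P x (j, k) = Arg (partial_matrix P x (j, k))" if "(j, k) \<in> lines P" for j k
    using that by (simp add: line_angle_def partial_matrix_line)
  show ?thesis
  proof
    assume "angle_recovery P x"
    then obtain \<theta> where \<theta>: "\<And>l. l \<in> lines P \<Longrightarrow>
        cis (\<Sum>j\<in>{1..nbus P}. incidence l j * \<theta> j) = cis (line_angle P x l)"
      by (auto simp: angle_recovery_def cis_eq_iff)
    define \<phi> where "\<phi> = \<theta>(0 := 0)"
    have "cis (Arg (partial_matrix P x (j, k))) = cis (\<phi> j - \<phi> k)" if "(j, k) \<in> lines P" for j k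
      using \<theta>[OF that] by (simp only: incidence_sum[OF that \<phi>_def] angle[OF that])
    then show "\<exists>\<phi>. \<forall>(j, k)\<in>lines P. cis (Arg (partial_matrix P x (j, k))) = cis (\<phi> j - \<phi> k)"
      by (intro exI[of _ \<phi>]) auto
  next
    assume "\<exists>\<phi>. \<forall>(j, k)\<in>lines P. cis (Arg (partial_matrix P x (j, k))) = cis (\<phi> j - \<phi> k)"
    then obtain \<phi> where \<phi>: "\<And>j k. (j, k) \<in> lines P \<Longrightarrow>
        cis (Arg (partial_matrix P x (j, k))) = cis (\<phi> j - \<phi> k)"
      by auto
    \<comment> \<open>Only differences of the potential matter, so it may be shifted to vanish at
      the slack bus.\<close>
    define \<theta> where "\<theta> i = \<phi> i - \<phi> 0" for i
    have normalised: "\<theta> = \<theta>(0 := 0)"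
      by (simp add: \<theta>_def fun_eq_iff)
    have "cis (\<Sum>i\<in>{1..nbus P}. incidence (j, k) i * \<theta> i) = cis (line_angle P x (j, k))"
      if "(j, k) \<in> lines P" for j k
      unfolding incidence_sum[OF that normalised] angle[OF that] \<phi>[OF that]
      by (simp add: \<theta>_def)
    then show "angle_recovery P x"
      unfolding angle_recovery_def cis_eq_iff[symmetric] by (intro exI[of _ \<theta>]) auto
  qed
qed

text \<open>Both conditions say that the angles are differences of a potential, one on all arcs and
  the other on the oriented lines. Antisymmetry of the angles makes the two agree.\<close>

lemma cycle_condition_iff_angle_recovery:
  assumes nz: "\<And>j k. (j, k) \<in> edges P \<Longrightarrow> partial_matrix P x (j, k) \<noteq> 0"
  shows "cycle_condition P (partial_matrix P x) \<longleftrightarrow> angle_recovery P x"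
proof -
  let ?W = "partial_matrix P x"
  \<comment> \<open>Conjugate nonzero numbers have inverse phases. The claim is put through
    \<open>cis\<close> because \<open>Arg\<close> takes the value pi on a negative real and on its
    conjugate alike, so it is odd only modulo 2 pi.\<close>
  have antisym: "cis (Arg (?W (j, k))) * cis (Arg (?W (k, j))) = 1" if "(j, k) \<in> edges P" for j k
  proof -
    have "?W (k, j) = cnj (?W (j, k))"
      by (rule partial_matrix_sym[OF that])
    then show ?thesis
      using nz[OF that] nz[OF edges_sym[OF that]]
      by (simp add: cis_Arg sgn_eq complex_norm_square power2_eq_square flip: complex_norm_square)
  qed
  have "cycle_condition P ?W \<longleftrightarrow>
      (\<forall>c. cycle c \<and> 3 \<le> length c \<longrightarrow> cis (\<Sum>e\<leftarrow>c. Arg (?W e)) = 1)"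
    unfolding cycle_condition_def cis_eq_iff[symmetric] by simp
  also have "\<dots> \<longleftrightarrow> (\<exists>\<phi>. \<forall>(j, k)\<in>edges P. cis (Arg (?W (j, k))) = cis (\<phi> j - \<phi> k))"
    by (rule cycle_condition_iff_potential[where a = "\<lambda>e. Arg (?W e)", OF connected_grid antisym])
  also have "\<dots> \<longleftrightarrow> (\<exists>\<phi>. \<forall>(j, k)\<in>lines P. cis (Arg (?W (j, k))) = cis (\<phi> j - \<phi> k))"
  proof (intro ex_cong1 ball_edges_iff_lines)
    fix \<phi> :: "nat \<Rightarrow> real" and j k assume "(j, k) \<in> edges P"
    then have "cis (Arg (?W (k, j))) = inverse (cis (Arg (?W (j, k))))"
      using antisym by (metis inverse_unique)
    moreover have "cis (\<phi> k - \<phi> j) = inverse (cis (\<phi> j - \<phi> k))"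
      by simp
    ultimately show "cis (Arg (?W (k, j))) = cis (\<phi> k - \<phi> j) \<longleftrightarrow>
        cis (Arg (?W (j, k))) = cis (\<phi> j - \<phi> k)"
      by (simp only: inverse_eq_iff_eq)
  qed
  finally show ?thesis
    by (simp only: angle_recovery_iff_potential)
qed

end

theorem theorem11:
  fixes P :: network
  assumes "power_network P"
  shows "(\<exists>f. bij_betw f (X_opf P) (W_opf P)) \<and>
         (\<exists>f. bij_betw f (X_nc P) (W_nc P)) \<and>
         (\<exists>f. bij_betw f (X_plus P) (W_plus P))"
proof -
  interpret power_network P by fact
  let ?f = "partial_matrix P"
  let ?A = "{x \<in> branch_space P. power_balance P x \<and> voltage_drop P x}"
  \<comment> \<open>A bijection restricts to subsets cut out by conditions that correspond under it,
    so each remaining claim is an equivalence of constraints.\<close>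
  note restrict = bij_betw_Collect[OF bij_betw_partial_matrix]
  \<comment> \<open>The matrix sets with rank one also demand semidefiniteness, whereas their branch
    flow counterparts state only the current equality; the latter implies the inequality.\<close>
  have ge: "current_eq P x \<Longrightarrow> current_ge P x" for x
    by (auto simp: current_eq_def current_ge_def)
  have "bij_betw ?f {x \<in> ?A. branch_bounds P x \<and> current_ge P x} (W_plus P)"
    unfolding W_plus_def by (rule restrict) (auto simp: bus_bounds_partial_matrix edges_psd_iff)
  moreover have "bij_betw ?f {x \<in> ?A. branch_bounds P x \<and> current_eq P x} (W_nc P)"
    unfolding W_nc_def by (rule restrict)
      (auto simp: bus_bounds_partial_matrix edges_psd_iff edges_rank1_iff ge)
  moreover have "bij_betw ?f
      {x \<in> ?A. branch_bounds P x \<and> current_eq P x \<and> angle_recovery P x} (W_opf P)"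
    unfolding W_opf_def by (rule restrict)
      (auto simp: bus_bounds_partial_matrix edges_psd_iff edges_rank1_iff ge
        cycle_condition_iff_angle_recovery partial_matrix_nonzero)
  moreover have "{x \<in> ?A. branch_bounds P x \<and> current_ge P x} = X_plus P"
      "{x \<in> ?A. branch_bounds P x \<and> current_eq P x} = X_nc P"
      "{x \<in> ?A. branch_bounds P x \<and> current_eq P x \<and> angle_recovery P x} = X_opf P"
    by (auto simp: X_plus_def X_nc_def X_opf_def)
  ultimately show ?thesis
    by auto
qed

end
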